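(* Let $K$ be a positive integer, let $p_A,p_B\in[0,1]$ with neither $p_A=p_B=0$ nor $p_A=p_B=1$, and let $q_A=1-p_A$, $q_B=1-p_B$. For a set with a $K$-points set tie-breaker in which player $A$ serves first, the probability $\theta_S(p_A,p_B,K)$ that $A$ wins the set is $$\theta_S(p_A,p_B,K)=\sum_{h=0}^4\theta_S(6,h;p_A,p_B)+\theta_S(7,5;p_A,p_B)+\theta_S(6,6;p_A,p_B)\,\theta_{ST}(p_A,p_B,K),$$ where, writing $\theta_S(a,b;p_A,p_B)$ for the probability that the set score $(a,b)$ occurs, $$\theta_S(6,h;p_A,p_B)=[\theta_G(p_A)]^{J_A(6+h)}[1-\theta_G(p_B)]^{1-J_A(6+h)}\sum_{j=0}^5\Big\{\binom{t_A(6+h-1)}{j}\binom{t_B(6+h-1)}{5-j}[\theta_G(p_A)]^j[1-\theta_G(p_A)]^{t_A(6+h-1)-j}$$ $$\qquad\times[1-\theta_G(p_B)]^{5-j}[\theta_G(p_B)]^{t_B(6+h-1)-(5-j)}\Big\},\qquad h=0,\ldots,4;$$ $$\theta_S(5,5;p_A,p_B)=\sum_{j=0}^5\binom{5}{j}^2[\theta_G(p_A)\theta_G(p_B)]^j[(1-\theta_G(p_A))(1-\theta_G(p_B))]^{5-j};$$ $$\theta_S(7,5;p_A,p_B)=\theta_S(5,5;p_A,p_B)\,\theta_G(p_A)[1-\theta_G(p_B)];$$ $$\theta_S(6,6;p_A,p_B)=\theta_S(5,5;p_A,p_B)\left[\theta_G(p_A)\theta_G(p_B)+(1-\theta_G(p_A))(1-\theta_G(p_B))\right].$$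 Alternatively, $$\theta_S(p_A,p_B,K)=\Pr\{B(5,\theta_G(p_A))+B(5,1-\theta_G(p_B))\ge 6\}+\Pr\{B(5,\theta_G(p_A))+B(5,1-\theta_G(p_B))=5\}$$ $$\qquad\times\Big[\theta_G(p_A)(1-\theta_G(p_B))+\big\{\theta_G(p_A)\theta_G(p_B)+(1-\theta_G(p_A))(1-\theta_G(p_B))\big\}\theta_{ST}(p_A,p_B,K)\Big],$$ where the two binomial random variables in each probability are independent. In addition, $\theta_S(p_A,p_B,K)=\theta_S(q_B,q_A,K)$.
   Context: Players $A$ and $B$ play points; all point outcomes are independent. When $A$ serves a point, $A$ wins it with probability $p_A$ (and $B$ wins it otherwise); when $B$ serves a point, $B$ wins it with probability $p_B$ (and $A$ wins it otherwise). Game: one player serves all points; the game is won by the first player with at least 4 points and an advantage of at least 2 points. $\theta_G(p)$ is the probability that the server wins a game when the server wins each point with probability $p$. $K$-point set tie-breaker: the first server $X$ and the other player $Y$ serve points in the sequence $XYYXXYYXX\ldots$; the first player to reach at least $K$ points with an advantage of at least two points wins (from a score of $K-1$ points each, play continues with the same serving sequence until one player is ahead by two). $\theta_{ST}(p_A,p_B,K)$ is the probability that $A$ wins the set tie-breaker when $A$ serves first in it. Set: the players alternate serving games, $A$ serving the first game. A player who first reaches 6 won games with an advantage of at least 2 games wins the set. If the score is 5 games each, a player who reaches 7 games while the opponent remains at 5 wins the set; if the score becomes 6 games each, the $K$-point set tie-breaker is played, with first server the player who received in the last game (i.e. $A$), and its winner wins the set. A set score $(a,b)$ means $A$ has won $a$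 games and $B$ has won $b$; $(6,h)$ with $h\le 4$ and $(7,5)$ are final scores, while $(5,5)$ and $(6,6)$ refer to that score being reached. $\theta_S(x,y,K)$ is the probability that the first server wins the set when the first server wins own-serve points with probability $x$ and the other player wins own-serve points with probability $y$. $t_A(g)=\lfloor (g+1)/2\rfloor$ and $t_B(g)=g-t_A(g)$ are the numbers of the first $g$ games served by $A$ and $B$; $J_A(g)=g\bmod 2$ indicates that $A$ serves the $g$th game. $B(m,r)$ denotes a binomial random variable with $m$ trials and success probability $r$. Conventions: $0^0=1$; $\binom{m}{k}=0$ if $k>m$, and any summand containing a zero binomial coefficient is $0$. *)

theory Defs
  imports "HOL-Probability.Probability"
begin

datatype player = Player_A | Player_B

fun opponent :: "player \<Rightarrow> player" where
  "opponent Player_A = Player_B"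
| "opponent Player_B = Player_A"

text \<open>All scores are pairs whose first component belongs to player A.\<close>

type_synonym score = "nat \<times> nat"

fun add_win :: "player \<Rightarrow> score \<Rightarrow> score" where
  "add_win Player_A (a, b) = (Suc a, b)"
| "add_win Player_B (a, b) = (a, Suc b)"

text \<open>At least \<open>m\<close> points (or games) and an advantage of at least two.\<close>

fun wins_by_two :: "nat \<Rightarrow> player \<Rightarrow> score \<Rightarrow> bool" where
  "wins_by_two m Player_A (a, b) \<longleftrightarrow> m \<le> a \<and> b + 2 \<le> a"
| "wins_by_two m Player_B (a, b) \<longleftrightarrow> m \<le> b \<and> a + 2 \<le> b"

text \<open>
  The randomness is an i.i.d. sequence of pairs of independent Bernoulli variables. The first
  component of the \<open>n\<close>-th pair says whether A wins the \<open>n\<close>-th point if A serves it, the second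
  whether B wins it if B serves it; who serves is determined by the points played before, so
  only one of the two components is used.
\<close>

definition points_space :: "real \<Rightarrow> real \<Rightarrow> (bool \<times> bool) stream measure" where
  "points_space p\<^sub>A p\<^sub>B =
     stream_space (measure_pmf (pair_pmf (bernoulli_pmf p\<^sub>A) (bernoulli_pmf p\<^sub>B)))"

fun point_winner :: "player \<Rightarrow> bool \<times> bool \<Rightarrow> player" where
  "point_winner Player_A (a, b) = (if a then Player_A else Player_B)"
| "point_winner Player_B (a, b) = (if b then Player_B else Player_A)"

text \<open>
  Winning a point in a contest played to at least \<open>m\<close> points and an advantage of two; the score is
  frozen once the contest is decided.
\<close>

definition score_point :: "nat \<Rightarrow> player \<Rightarrow> score \<Rightarrow> score" where
  "score_point m w s = (if \<exists>v. wins_by_two m v s then s else add_win w s)"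

text \<open>In a single game only the server's point-winning probability matters; A is the server.\<close>

definition \<theta>\<^sub>G :: "real \<Rightarrow> real" where
  "\<theta>\<^sub>G p = \<P>(\<omega> in stream_space (measure_pmf (bernoulli_pmf p)).
     \<exists>n. wins_by_two 4 Player_A
       (fold (\<lambda>win. score_point 4 (if win then Player_A else Player_B)) (stake n \<omega>) (0, 0)))"

text \<open>
  Server of the point with index \<open>n\<close> (counted from 0) in the sequence
  \<open>X, Y, Y, X, X, Y, Y, X, X, \<dots>\<close>
\<close>

definition tiebreak_server :: "player \<Rightarrow> nat \<Rightarrow> player" where
  "tiebreak_server X n = (if n mod 4 \<in> {0, 3} then X else opponent X)"

definition tiebreak_step :: "nat \<Rightarrow> bool \<times> bool \<Rightarrow> score \<Rightarrow> score" where
  "tiebreak_step K u s =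
     score_point K (point_winner (tiebreak_server Player_A (fst s + snd s)) u) s"

definition \<theta>\<^sub>S\<^sub>T :: "real \<Rightarrow> real \<Rightarrow> nat \<Rightarrow> real" where
  "\<theta>\<^sub>S\<^sub>T p\<^sub>A p\<^sub>B K = \<P>(\<omega> in points_space p\<^sub>A p\<^sub>B.
     \<exists>n. wins_by_two K Player_A (fold (tiebreak_step K) (stake n \<omega>) (0, 0)))"

text \<open>
  A state of the set consists of the game score and the point score in the current game; at game
  score \<open>(6, 6)\<close> the ``current game'' is the set tie-breaker, which takes the game score to
  \<open>(7, 6)\<close> or \<open>(6, 7)\<close>.
\<close>

type_synonym set_state = "score \<times> score"

fun wins_set :: "player \<Rightarrow> score \<Rightarrow> bool" where
  "wins_set w g \<longleftrightarrow> wins_by_two 6 w g \<or> g = add_win w (6, 6)"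

text \<open>
  A serves first in the games preceded by an even number of games. For the tie-breaker (preceded
  by 12 games) this is the player who received in the last game.
\<close>

definition game_server :: "score \<Rightarrow> player" where
  "game_server g = (if even (fst g + snd g) then Player_A else Player_B)"

definition point_server :: "set_state \<Rightarrow> player" where
  "point_server = (\<lambda>(g, s).
     if g = (6, 6) then tiebreak_server (game_server g) (fst s + snd s) else game_server g)"

definition set_step :: "nat \<Rightarrow> bool \<times> bool \<Rightarrow> set_state \<Rightarrow> set_state" where
  "set_step K u = (\<lambda>(g, s).
     if \<exists>v. wins_set v g then (g, s)
     else
       let w = point_winner (point_server (g, s)) u;
           s' = add_win w s
       in if wins_by_two (if g = (6, 6) then K else 4) w s' then (add_win w g, (0, 0)) else (g, s'))"

definition set_after :: "nat \<Rightarrow> (bool \<times> bool) stream \<Rightarrow> nat \<Rightarrow> set_state" where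
  "set_after K \<omega> n = fold (set_step K) (stake n \<omega>) ((0, 0), (0, 0))"

definition \<theta>\<^sub>S :: "real \<Rightarrow> real \<Rightarrow> nat \<Rightarrow> real" where
  "\<theta>\<^sub>S x y K = \<P>(\<omega> in points_space x y. \<exists>n. wins_set Player_A (fst (set_after K \<omega> n)))"

text \<open>
  Probability that the set score \<open>(a, b)\<close> occurs. The parameter \<open>K\<close> is needed to define the play;
  it influences only what happens after the score \<open>(6, 6)\<close>.
\<close>

definition \<theta>\<^sub>S_score :: "nat \<Rightarrow> nat \<Rightarrow> nat \<Rightarrow> real \<Rightarrow> real \<Rightarrow> real" where
  "\<theta>\<^sub>S_score K a b p\<^sub>A p\<^sub>B = \<P>(\<omega> in points_space p\<^sub>A p\<^sub>B. \<exists>n. fst (set_after K \<omega> n) = (a, b))"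

definition t\<^sub>A :: "nat \<Rightarrow> nat" where
  "t\<^sub>A g = (g + 1) div 2"

definition t\<^sub>B :: "nat \<Rightarrow> nat" where
  "t\<^sub>B g = g - t\<^sub>A g"

definition J\<^sub>A :: "nat \<Rightarrow> nat" where
  "J\<^sub>A g = g mod 2"

text \<open>The distribution of \<open>B(m, r) + B(n, s)\<close> for independent binomial variables.\<close>

definition binomial_sum_pmf :: "nat \<Rightarrow> real \<Rightarrow> nat \<Rightarrow> real \<Rightarrow> nat pmf" where
  "binomial_sum_pmf m r n s =
     map_pmf (\<lambda>(x, y). x + y) (pair_pmf (binomial_pmf m r) (binomial_pmf n s))"

end

theory Submission
  imports Defs
begin

text \<open>
  The points are not regrouped into independent games along random times, as a strong Markov
  argument would do. Instead, every probability is read as a function of the current score that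
  satisfies the first-step equation (the value now is the average of the values after the next
  point). A bounded such function is determined at \<open>(0, 0)\<close> by its values at the decided scores, and
  this uniqueness carries the whole argument.

  Uniqueness holds for any contest won by a lead of two (\<open>contest_value_unique\<close>), because the
  points can be taken in consecutive pairs. From a late tie, a pair decides the contest unless it
  is shared, and the probability of sharing a pair is bounded by some \<open>\<rho> < 1\<close>, so the difference
  of two solutions contracts from tie to tie and vanishes; from there it vanishes backwards,
  pair by pair, down to \<open>(0, 0)\<close>. For a game \<open>\<rho> = 1/2\<close> works with every \<open>p\<close>. For the tie-breaker the bound is
  \<open>p\<^sub>A p\<^sub>B + q\<^sub>A q\<^sub>B\<close>, which is less than 1 exactly when neither \<open>p\<^sub>A = p\<^sub>B = 0\<close> nor
  \<open>p\<^sub>A = p\<^sub>B = 1\<close>. Moreover, only the joint law of a pair of points matters, not the order of the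
  two points within it. This gives three consequences:

  \<^item> Whatever A's value is after winning and after losing the current game, the value at its start
    is their average with weight \<open>\<theta>\<^sub>G p\<close>, where \<open>p\<close> is A's chance of winning a point
    of that game (\<open>game_value\<close>); similarly for the tie-breaker (\<open>tiebreak_value\<close>). Hence the set
    is a walk on the game scores.
  \<^item> \<open>\<theta>\<^sub>G (1 - p) = 1 - \<theta>\<^sub>G p\<close>, by exchanging the players (\<open>theta_G_complement\<close>). So A wins
    a game served by B with probability \<open>1 - \<theta>\<^sub>G p\<^sub>B\<close>.
  \<^item> \<open>\<theta>\<^sub>S\<^sub>T\<close> is unchanged under \<open>(p\<^sub>A, p\<^sub>B) \<mapsto> (q\<^sub>B, q\<^sub>A)\<close>, since each pair of points in the
    serving sequence has one serve of each player, and the exchange only reverses the order in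
    each pair (\<open>theta_ST_exchange\<close>).

  In the walk on game scores, a value function whose first-step equation holds for the first \<open>N\<close>
  games has at \<open>(0, 0)\<close> the mean of its values after \<open>N\<close> games, and the number of games won by A
  is then a sum of two binomial variables (\<open>alternating_walk_expectation\<close>). With \<open>N = 5 + h\<close> this
  yields the score \<open>(6, h)\<close>. With \<open>N = 10\<close> it yields the late scores and the binomial form of
  \<open>\<theta>\<^sub>S\<close>: a set decided within ten games may be played on to the tenth, because the winner
  is then exactly the player with at least six of ten games. The binomial form shows the invariance
  of \<open>\<theta>\<^sub>S\<close>, because the exchange swaps A's winning chances \<open>\<theta>\<^sub>G p\<^sub>A\<close> and \<open>1 - \<theta>\<^sub>G p\<^sub>B\<close>.
\<close>

section \<open>Reaching a target from a random walk driven by independent inputs\<close>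

definition reach_prob :: "'u pmf \<Rightarrow> ('u \<Rightarrow> 's \<Rightarrow> 's) \<Rightarrow> ('s \<Rightarrow> bool) \<Rightarrow> 's \<Rightarrow> real" where
  "reach_prob D step tgt s =
     \<P>(\<omega> in stream_space (measure_pmf D). \<exists>n. tgt (fold step (stake n \<omega>) s))"

lemma reach_prob_bounds: "0 \<le> reach_prob D step tgt s" "reach_prob D step tgt s \<le> 1"
proof -
  interpret prob_space "stream_space (measure_pmf D)"
    by (rule prob_space.prob_space_stream_space[OF prob_space_measure_pmf])
  show "0 \<le> reach_prob D step tgt s" "reach_prob D step tgt s \<le> 1"
    by (simp_all add: reach_prob_def)
qed

lemma reach_prob_target:
  assumes "tgt s"
  shows "reach_prob D step tgt s = 1"
proof -
  interpret prob_space "stream_space (measure_pmf D)"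
    by (rule prob_space.prob_space_stream_space[OF prob_space_measure_pmf])
  have "\<exists>n. tgt (fold step (stake n \<omega>) s)" for \<omega>
    by (rule exI[of _ 0]) (simp add: assms)
  then show ?thesis
    by (simp add: reach_prob_def prob_space)
qed

lemma reach_prob_unreachable:
  assumes "I s"
    and "\<And>u s. I s \<Longrightarrow> I (step u s)"
    and "\<And>s. I s \<Longrightarrow> \<not> tgt s"
  shows "reach_prob D step tgt s = 0"
proof -
  have "I (fold step us s)" for us
    using assms(1) by (induction us arbitrary: s) (auto intro: assms(2))
  then show ?thesis
    by (simp add: reach_prob_def assms(3))
qed

text \<open>
  The first-step equation: conditionally on the first input, the rest of the stream is again an
  i.i.d. stream.
\<close>

lemma reach_prob_step:
  fixes D :: "'u :: countable pmf"
  assumes "\<not> tgt s"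
  shows "reach_prob D step tgt s =
    measure_pmf.expectation D (\<lambda>u. reach_prob D step tgt (step u s))"
proof -
  let ?M = "stream_space (measure_pmf D)"
  interpret S: prob_space ?M
    by (rule prob_space.prob_space_stream_space[OF prob_space_measure_pmf])
  have [measurable_cong]: "sets ?M = sets (stream_space (count_space UNIV))"
    by (rule sets_stream_space_cong) simp
  have [measurable]: "Measurable.pred (count_space UNIV) (\<lambda>us. tgt (fold step us s))" for s
    by simp
  have meas: "{\<omega>\<in>space ?M. \<exists>n. tgt (fold step (stake n \<omega>) s)} \<in> sets ?M"
    by measurable
  have first_step: "(\<exists>n. tgt (fold step (stake n (u ## \<omega>)) s)) \<longleftrightarrow>
      (\<exists>n. tgt (fold step (stake n \<omega>) (step u s)))" for u \<omega>
  proof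
    assume "\<exists>n. tgt (fold step (stake n (u ## \<omega>)) s)"
    then obtain n where "tgt (fold step (stake n (u ## \<omega>)) s)" ..
    with assms show "\<exists>n. tgt (fold step (stake n \<omega>) (step u s))"
      by (cases n) auto
  next
    assume "\<exists>n. tgt (fold step (stake n \<omega>) (step u s))"
    then obtain n where "tgt (fold step (stake n \<omega>) (step u s))" ..
    then show "\<exists>n. tgt (fold step (stake n (u ## \<omega>)) s)"
      by (intro exI[of _ "Suc n"]) simp
  qed
  have "ennreal (reach_prob D step tgt s) =
      (\<integral>\<^sup>+u. ennreal (reach_prob D step tgt (step u s)) \<partial>measure_pmf D)"
    unfolding reach_prob_def by (subst prob_space.prob_stream_space[OF prob_space_measure_pmf meas]) (simp only: first_step)
  also have "\<dots> = ennreal (measure_pmf.expectation D (\<lambda>u. reach_prob D step tgt (step u s)))"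
    by (intro nn_integral_eq_integral measure_pmf.integrable_const_bound[where B=1])
      (auto simp: reach_prob_bounds)
  finally show ?thesis
    by (simp add: reach_prob_bounds integral_nonneg_AE)
qed


section \<open>Contests decided by a lead of two points\<close>

lemma wins_by_two_unique: "wins_by_two m v s \<Longrightarrow> wins_by_two m w s \<Longrightarrow> v = w"
  by (cases v; cases w; cases s) auto

text \<open>
  Possible values, as a function of the score, of a contest worth \<open>x\<close> if A wins it and \<open>y\<close> if B does,
  where \<open>c n\<close> is A's chance to win the point that follows \<open>n\<close> points. Boundedness excludes the
  spurious solutions that grow along the ties.
\<close>

definition contest_value ::
  "nat \<Rightarrow> (nat \<Rightarrow> real) \<Rightarrow> real \<Rightarrow> real \<Rightarrow> (score \<Rightarrow> real) \<Rightarrow> bool" where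
  "contest_value m c x y f \<longleftrightarrow>
     (\<exists>M. \<forall>s. \<bar>f s\<bar> \<le> M)
     \<and> (\<forall>s. wins_by_two m Player_A s \<longrightarrow> f s = x)
     \<and> (\<forall>s. wins_by_two m Player_B s \<longrightarrow> f s = y)
     \<and> (\<forall>a b. (\<forall>v. \<not> wins_by_two m v (a, b)) \<longrightarrow>
          f (a, b) = c (a + b) * f (Suc a, b) + (1 - c (a + b)) * f (a, Suc b))"

lemma contest_value_decided:
  assumes "contest_value m c x y f"
  shows "wins_by_two m Player_A s \<Longrightarrow> f s = x" "wins_by_two m Player_B s \<Longrightarrow> f s = y"
  using assms unfolding contest_value_def by blast+

text \<open>
  Grouping points into pairs loses nothing: if the first point of a pair decides the contest, the
  winner then leads by at least three, so that the second point cannot undo the win.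
\<close>

lemma contest_value_pair_of_points:
  assumes f: "contest_value m c x y f"
    and open_score: "\<And>v. \<not> wins_by_two m v (a, b)" and ev: "even (a + b)"
  shows "f (a, b) =
     c (a + b) * c (Suc (a + b)) * f (a + 2, b)
     + (c (a + b) * (1 - c (Suc (a + b))) + (1 - c (a + b)) * c (Suc (a + b))) * f (Suc a, Suc b)
     + (1 - c (a + b)) * (1 - c (Suc (a + b))) * f (a, b + 2)"
proof -
  let ?c = "c (Suc (a + b))"
  have fA: "wins_by_two m Player_A s \<Longrightarrow> f s = x"
    and fB: "wins_by_two m Player_B s \<Longrightarrow> f s = y" for s
    using contest_value_decided[OF f] by blast+
  have step: "(\<And>v. \<not> wins_by_two m v (a, b)) \<Longrightarrow>
      f (a, b) = c (a + b) * f (Suc a, b) + (1 - c (a + b)) * f (a, Suc b)" for a b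
    using f by (auto simp: contest_value_def)
  have nA: "\<not> (m \<le> a \<and> b + 2 \<le> a)" and nB: "\<not> (m \<le> b \<and> a + 2 \<le> b)"
    using open_score[of Player_A] open_score[of Player_B] by auto
  have A: "f (Suc a, b) = ?c * f (a + 2, b) + (1 - ?c) * f (Suc a, Suc b)"
  proof (cases "wins_by_two m Player_A (Suc a, b)")
    case True
    \<comment> \<open>By parity, a lead of two after an odd number of points is a lead of three.\<close>
    moreover from this have "b + 3 \<le> Suc a"
      using ev by (cases "Suc a = b + 2") auto
    ultimately show ?thesis
      by (simp add: fA algebra_simps)
  next
    case False
    moreover have "\<not> wins_by_two m Player_B (Suc a, b)"
      using nB by auto
    ultimately have "\<not> wins_by_two m v (Suc a, b)" for v
      by (cases v) auto
    from step[OF this] show ?thesis by simp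
  qed
  have B: "f (a, Suc b) = ?c * f (Suc a, Suc b) + (1 - ?c) * f (a, b + 2)"
  proof (cases "wins_by_two m Player_B (a, Suc b)")
    case True
    moreover from this have "a + 3 \<le> Suc b"
      using ev by (cases "Suc b = a + 2") auto
    ultimately show ?thesis
      by (simp add: fB algebra_simps)
  next
    case False
    moreover have "\<not> wins_by_two m Player_A (a, Suc b)"
      using nA by auto
    ultimately have "\<not> wins_by_two m v (a, Suc b)" for v
      by (cases v) auto
    from step[OF this] show ?thesis by simp
  qed
  show ?thesis
    by (subst step[OF open_score], subst A, subst B) (simp add: algebra_simps)
qed

text \<open>
  The values depend on the chances only through the product and the sum over each pair of points,
  that is, through the probabilities that A wins two, one or none of the two points. Hence the two
  contests compared here may have the serves within a pair in different orders.
\<close>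

lemma contest_value_unique:
  assumes f: "contest_value m c x y f" and g: "contest_value m d x y g"
    and prod: "\<And>n. even n \<Longrightarrow> c n * c (Suc n) = d n * d (Suc n)"
    and sum: "\<And>n. even n \<Longrightarrow> c n + c (Suc n) = d n + d (Suc n)"
    and bound: "\<And>n. even n \<Longrightarrow> \<bar>c n * (1 - c (Suc n)) + (1 - c n) * c (Suc n)\<bar> \<le> \<rho>"
    and \<rho>: "\<rho> < 1"
  shows "f (0, 0) = g (0, 0)"
proof -
  define D where "D s = f s - g s" for s
  obtain M1 M2 where "\<And>s. \<bar>f s\<bar> \<le> M1" "\<And>s. \<bar>g s\<bar> \<le> M2"
    using f g unfolding contest_value_def by blast
  then have "\<bar>D s\<bar> \<le> M1 + M2" for s
    unfolding D_def by (meson abs_triangle_ineq4 add_mono order_trans)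
  then obtain M where M: "\<And>s. \<bar>D s\<bar> \<le> M" by blast
  have decided: "D s = 0" if "wins_by_two m v s" for s v
    using that contest_value_decided[OF f] contest_value_decided[OF g] by (cases v) (simp_all add: D_def)
  have D2: "D (a, b) =
     c (a + b) * c (Suc (a + b)) * D (a + 2, b)
     + (c (a + b) * (1 - c (Suc (a + b))) + (1 - c (a + b)) * c (Suc (a + b))) * D (Suc a, Suc b)
     + (1 - c (a + b)) * (1 - c (Suc (a + b))) * D (a, b + 2)"
    if "\<And>v. \<not> wins_by_two m v (a, b)" and ev: "even (a + b)" for a b
  proof -
    let ?n = "a + b"
    have 1: "c ?n * (1 - c (Suc ?n)) + (1 - c ?n) * c (Suc ?n) =
        d ?n * (1 - d (Suc ?n)) + (1 - d ?n) * d (Suc ?n)"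
      using prod[OF ev] sum[OF ev] by (simp add: algebra_simps)
    have 2: "(1 - c ?n) * (1 - c (Suc ?n)) = (1 - d ?n) * (1 - d (Suc ?n))"
      using prod[OF ev] sum[OF ev] by (simp add: algebra_simps)
    show ?thesis
      unfolding D_def contest_value_pair_of_points[OF f that]
        contest_value_pair_of_points[OF g that] prod[OF ev] 1 2
      by (simp add: algebra_simps)
  qed
  \<comment> \<open>From a tie with at least \<open>m - 1\<close> points each, two points decide the contest unless they are
    shared, so the difference at consecutive ties contracts by the factor \<open>\<rho>\<close>.\<close>
  have tie_bound: "\<bar>D (a, a)\<bar> \<le> \<rho> ^ k * M" if "m \<le> Suc a" for a k
    using that
  proof (induction k arbitrary: a)
    case 0
    then show ?case using M by simp
  next
    case (Suc k)
    have no: "\<not> wins_by_two m v (a, a)" for v by (cases v) auto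
    have "D (a + 2, a) = 0" "D (a, a + 2) = 0"
      using decided[of Player_A "(a + 2, a)"] decided[of Player_B "(a, a + 2)"] Suc.prems by auto
    then have "D (a, a) = (c (a + a) * (1 - c (Suc (a + a)))
        + (1 - c (a + a)) * c (Suc (a + a))) * D (Suc a, Suc a)"
      using D2[OF no] by simp
    moreover have "0 \<le> \<rho>"
      using bound[of 0] by simp
    ultimately have "\<bar>D (a, a)\<bar> \<le> \<rho> * \<bar>D (Suc a, Suc a)\<bar>"
      using bound[of "a + a"] by (simp add: abs_mult mult_right_mono)
    also have "\<dots> \<le> \<rho> * (\<rho> ^ k * M)"
      using Suc.IH[of "Suc a"] Suc.prems \<open>0 \<le> \<rho>\<close> by (intro mult_left_mono) auto
    finally show ?case by simp
  qed
  have tie: "D (a, a) = 0" if "m \<le> Suc a" for a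
  proof -
    have "(\<lambda>k. \<rho> ^ k * M) \<longlonglongrightarrow> 0 * M"
      using bound[of 0] \<rho> by (intro tendsto_mult LIMSEQ_power_zero tendsto_const) auto
    then have "\<bar>D (a, a)\<bar> \<le> 0"
      using tie_bound[OF that] by (intro LIMSEQ_le_const[of _ 0]) auto
    then show ?thesis by simp
  qed
  \<comment> \<open>Backward induction; an open score with an even number of points, at least \<open>2 * m - 2\<close>, is a
    tie.\<close>
  have "D (a, b) = 0" if "even (a + b)" for a b
    using that
  proof (induction "2 * m - (a + b)" arbitrary: a b rule: less_induct)
    case less
    show ?case
    proof (cases "\<exists>v. wins_by_two m v (a, b)")
      case True
      then show ?thesis using decided by blast
    next
      case False
      then have no: "\<not> wins_by_two m v (a, b)" for v by blast
      show ?thesis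
      proof (cases "2 * m \<le> a + b + 2")
        case True
        have "a = b"
          using no[of Player_A] no[of Player_B] True less.prems
          by (cases a b rule: linorder_cases; simp; presburger)
        with True show ?thesis using tie[of a] by simp
      next
        case False
        have "D (a + 2, b) = 0" "D (Suc a, Suc b) = 0" "D (a, b + 2) = 0"
          using False less.prems by (auto intro!: less.hyps)
        then show ?thesis using D2[OF no less.prems] by simp
      qed
    qed
  qed
  from this[of 0 0] show ?thesis by (simp add: D_def)
qed

text \<open>
  Together with uniqueness, this expresses the value of a contest with arbitrary stakes through the
  probability that A wins it.
\<close>

lemma contest_value_affine:
  assumes "contest_value m c 1 0 V"
  shows "contest_value m c x y (\<lambda>s. V s * x + (1 - V s) * y)"
proof -
  obtain M where M: "\<And>s. \<bar>V s\<bar> \<le> M"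
    using assms unfolding contest_value_def by blast
  have "\<bar>V s * x + (1 - V s) * y\<bar> \<le> M * \<bar>x\<bar> + (1 + M) * \<bar>y\<bar>" for s
  proof -
    have "\<bar>V s * x + (1 - V s) * y\<bar> \<le> \<bar>V s\<bar> * \<bar>x\<bar> + \<bar>1 - V s\<bar> * \<bar>y\<bar>"
      by (metis abs_mult abs_triangle_ineq)
    also have "\<dots> \<le> M * \<bar>x\<bar> + (1 + M) * \<bar>y\<bar>"
      using M[of s] by (intro add_mono mult_right_mono) auto
    finally show ?thesis .
  qed
  moreover have "V (a, b) * x + (1 - V (a, b)) * y =
      c (a + b) * (V (Suc a, b) * x + (1 - V (Suc a, b)) * y)
      + (1 - c (a + b)) * (V (a, Suc b) * x + (1 - V (a, Suc b)) * y)"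
    if "V (a, b) = c (a + b) * V (Suc a, b) + (1 - c (a + b)) * V (a, Suc b)" for a b
    unfolding that by (simp add: algebra_simps)
  ultimately show ?thesis
    using assms unfolding contest_value_def by auto
qed

text \<open>
  If \<open>V\<close> is A's winning probability, then \<open>1 - V\<close> is the probability that A does not win. It has the
  same values at the decided scores as B's winning probability, so uniqueness will identify the two
  without a separate proof that the contest ends.
\<close>

lemma contest_value_swap:
  assumes V: "contest_value m c 1 0 V"
  shows "contest_value m (\<lambda>n. 1 - c n) 1 0 (\<lambda>s. 1 - V (prod.swap s))"
proof -
  obtain M where M: "\<And>s. \<bar>V s\<bar> \<le> M"
    using V unfolding contest_value_def by blast
  have swap: "wins_by_two m v (b, a) \<longleftrightarrow> wins_by_two m (opponent v) (a, b)" for v a b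
    by (cases v) auto
  have "\<bar>1 - V s\<bar> \<le> 1 + M" for s
    using M[of s] by auto
  moreover have "wins_by_two m Player_A s \<Longrightarrow> 1 - V (prod.swap s) = 1"
    "wins_by_two m Player_B s \<Longrightarrow> 1 - V (prod.swap s) = 0" for s
    by (cases s; simp add: contest_value_decided[OF V])+
  moreover have "1 - V (b, a) = (1 - c (a + b)) * (1 - V (b, Suc a))
      + (1 - (1 - c (a + b))) * (1 - V (Suc b, a))"
    if no: "\<And>v. \<not> wins_by_two m v (a, b)" for a b
  proof -
    have "\<not> wins_by_two m v (b, a)" for v
      using no[of "opponent v"] swap[of v b a] by blast
    then have "V (b, a) = c (b + a) * V (Suc b, a) + (1 - c (b + a)) * V (b, Suc a)"
      using V unfolding contest_value_def by blast
    then show ?thesis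
      by (simp add: algebra_simps)
  qed
  ultimately show ?thesis
    unfolding contest_value_def prod.swap_def fst_conv snd_conv by blast
qed


section \<open>Games and tie-breakers as contests\<close>

lemma expectation_point_winner:
  assumes "x \<in> {0..1}" "y \<in> {0..1}"
  shows "measure_pmf.expectation (pair_pmf (bernoulli_pmf x) (bernoulli_pmf y))
      (\<lambda>u. h (point_winner srv u)) =
    (if srv = Player_A then x else 1 - y) * h Player_A
    + (1 - (if srv = Player_A then x else 1 - y)) * (h Player_B :: real)"
proof (cases srv)
  case Player_A
  have "point_winner Player_A = (\<lambda>u. if fst u then Player_A else Player_B)"
    by auto
  moreover have "measure_pmf.expectation (pair_pmf (bernoulli_pmf x) (bernoulli_pmf y))
      (\<lambda>u. h (if fst u then Player_A else Player_B)) =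
    measure_pmf.expectation (bernoulli_pmf x) (\<lambda>b. h (if b then Player_A else Player_B))"
    by (rule expectation_pair_pmf_fst)
  ultimately show ?thesis
    using assms Player_A by simp
next
  case Player_B
  have "point_winner Player_B = (\<lambda>u. if snd u then Player_B else Player_A)"
    by auto
  moreover have "measure_pmf.expectation (pair_pmf (bernoulli_pmf x) (bernoulli_pmf y))
      (\<lambda>u. h (if snd u then Player_B else Player_A)) =
    measure_pmf.expectation (bernoulli_pmf y) (\<lambda>b. h (if b then Player_B else Player_A))"
    by (rule expectation_pair_pmf_snd)
  ultimately show ?thesis
    using assms Player_B by simp
qed

text \<open>
  Winning probabilities are values of the contest with stakes 1 and 0. At scores won by B the
  probability is 0 because a decided score is frozen.
\<close>

lemma contest_value_reach_prob:
  fixes D :: "'u :: countable pmf"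
  assumes frozen: "\<And>u v s. wins_by_two m v s \<Longrightarrow> step u s = s"
    and point: "\<And>a b h. (\<And>v. \<not> wins_by_two m v (a, b)) \<Longrightarrow>
      measure_pmf.expectation D (\<lambda>u. h (step u (a, b))) =
        c (a + b) * h (Suc a, b) + (1 - c (a + b)) * (h (a, Suc b) :: real)"
  shows "contest_value m c 1 0 (reach_prob D step (wins_by_two m Player_A))"
  unfolding contest_value_def
proof (intro conjI allI impI exI)
  fix s
  show "\<bar>reach_prob D step (wins_by_two m Player_A) s\<bar> \<le> 1"
    by (simp add: reach_prob_bounds)
next
  fix s assume "wins_by_two m Player_A s"
  then show "reach_prob D step (wins_by_two m Player_A) s = 1"
    by (rule reach_prob_target)
next
  fix s assume "wins_by_two m Player_B s"
  then show "reach_prob D step (wins_by_two m Player_A) s = 0"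
    using frozen wins_by_two_unique[of m Player_A s Player_B]
    by (intro reach_prob_unreachable[where I = "\<lambda>t. t = s"]) auto
next
  fix a b assume no: "\<forall>v. \<not> wins_by_two m v (a, b)"
  then have "reach_prob D step (wins_by_two m Player_A) (a, b) =
      measure_pmf.expectation D (\<lambda>u. reach_prob D step (wins_by_two m Player_A) (step u (a, b)))"
    by (intro reach_prob_step) blast
  also have "\<dots> = c (a + b) * reach_prob D step (wins_by_two m Player_A) (Suc a, b)
      + (1 - c (a + b)) * reach_prob D step (wins_by_two m Player_A) (a, Suc b)"
    using no by (intro point) blast
  finally show "reach_prob D step (wins_by_two m Player_A) (a, b) = \<dots>" .
qed

definition game_win_prob :: "real \<Rightarrow> score \<Rightarrow> real" where
  "game_win_prob p = reach_prob (bernoulli_pmf p)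
     (\<lambda>win. score_point 4 (if win then Player_A else Player_B)) (wins_by_two 4 Player_A)"

definition tiebreak_win_prob :: "real \<Rightarrow> real \<Rightarrow> nat \<Rightarrow> score \<Rightarrow> real" where
  "tiebreak_win_prob x y K = reach_prob (pair_pmf (bernoulli_pmf x) (bernoulli_pmf y))
     (tiebreak_step K) (wins_by_two K Player_A)"

definition tiebreak_chance :: "real \<Rightarrow> real \<Rightarrow> nat \<Rightarrow> real" where
  "tiebreak_chance x y n = (if tiebreak_server Player_A n = Player_A then x else 1 - y)"

lemma theta_G_eq: "\<theta>\<^sub>G p = game_win_prob p (0, 0)"
  by (simp add: \<theta>\<^sub>G_def game_win_prob_def reach_prob_def)

lemma theta_ST_eq: "\<theta>\<^sub>S\<^sub>T x y K = tiebreak_win_prob x y K (0, 0)"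
  by (simp add: \<theta>\<^sub>S\<^sub>T_def tiebreak_win_prob_def reach_prob_def points_space_def)

lemma game_win_prob_value:
  assumes "p \<in> {0..1}"
  shows "contest_value 4 (\<lambda>_. p) 1 0 (game_win_prob p)"
  unfolding game_win_prob_def
proof (rule contest_value_reach_prob)
  show "score_point 4 (if u then Player_A else Player_B) s = s" if "wins_by_two 4 v s" for u v s
    using that by (auto simp: score_point_def)
next
  fix a b and h :: "score \<Rightarrow> real"
  assume "\<And>v. \<not> wins_by_two 4 v (a, b)"
  then show "measure_pmf.expectation (bernoulli_pmf p)
      (\<lambda>u. h (score_point 4 (if u then Player_A else Player_B) (a, b))) =
    p * h (Suc a, b) + (1 - p) * h (a, Suc b)"
    using assms by (simp add: score_point_def del: wins_by_two.simps)
qed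

lemma tiebreak_win_prob_value:
  assumes "x \<in> {0..1}" "y \<in> {0..1}"
  shows "contest_value K (tiebreak_chance x y) 1 0 (tiebreak_win_prob x y K)"
  unfolding tiebreak_win_prob_def
proof (rule contest_value_reach_prob)
  show "tiebreak_step K u s = s" if "wins_by_two K v s" for u v s
    using that by (auto simp: tiebreak_step_def score_point_def)
next
  fix a b and h :: "score \<Rightarrow> real"
  assume "\<And>v. \<not> wins_by_two K v (a, b)"
  then have "tiebreak_step K u (a, b) =
      add_win (point_winner (tiebreak_server Player_A (a + b)) u) (a, b)" for u
    by (simp add: tiebreak_step_def score_point_def del: wins_by_two.simps)
  then show "measure_pmf.expectation (pair_pmf (bernoulli_pmf x) (bernoulli_pmf y))
      (\<lambda>u. h (tiebreak_step K u (a, b))) =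
    tiebreak_chance x y (a + b) * h (Suc a, b) + (1 - tiebreak_chance x y (a + b)) * h (a, Suc b)"
    using expectation_point_winner[OF assms, of "\<lambda>w. h (add_win w (a, b))"]
    by (simp add: tiebreak_chance_def)
qed

lemma theta_G_bounds: "\<theta>\<^sub>G p \<in> {0..1}"
  by (simp add: theta_G_eq game_win_prob_def reach_prob_bounds)

lemma shared_game_points:
  assumes "p \<in> {0..1}"
  shows "\<bar>p * (1 - p) + (1 - p) * p\<bar> \<le> (1 / 2 :: real)"
proof -
  have "0 \<le> p * (1 - p)" "0 \<le> (1 - 2 * p)\<^sup>2"
    using assms by auto
  then show ?thesis by (simp add: power2_eq_square algebra_simps)
qed

text \<open>
  In particular, a game ends almost surely for every \<open>p\<close>, including \<open>0\<close> and \<open>1\<close>: with stakes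
  \<open>x = y = 1\<close> its value is 1.
\<close>

lemma game_value:
  assumes "p \<in> {0..1}" "contest_value 4 (\<lambda>_. p) x y f"
  shows "f (0, 0) = \<theta>\<^sub>G p * x + (1 - \<theta>\<^sub>G p) * y"
  unfolding theta_G_eq
  by (rule contest_value_unique[where \<rho> = "1 / 2",
        OF assms(2) contest_value_affine[OF game_win_prob_value[OF assms(1)]]])
    (use shared_game_points[OF assms(1)] in auto)

lemma theta_G_complement:
  assumes "p \<in> {0..1}"
  shows "\<theta>\<^sub>G (1 - p) = 1 - \<theta>\<^sub>G p"
  using game_value[OF _ contest_value_swap[OF game_win_prob_value[OF assms]]] assms
  by (simp add: theta_G_eq)

text \<open>
  In the order X, Y, Y, X, each of the two consecutive pairs contains one serve of each player.
\<close>

lemma tiebreak_chance_pair: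
  assumes "even n"
  shows "(tiebreak_chance x y n = x \<and> tiebreak_chance x y (Suc n) = 1 - y)
    \<or> (tiebreak_chance x y n = 1 - y \<and> tiebreak_chance x y (Suc n) = x)"
proof -
  have "n mod 4 = 0 \<or> n mod 4 = 2" using assms by presburger
  then show ?thesis
  proof
    assume "n mod 4 = 0"
    moreover then have "Suc n mod 4 = 1" by presburger
    ultimately show ?thesis by (simp add: tiebreak_chance_def tiebreak_server_def)
  next
    assume "n mod 4 = 2"
    moreover then have "Suc n mod 4 = 3" by presburger
    ultimately show ?thesis by (simp add: tiebreak_chance_def tiebreak_server_def)
  qed
qed

text \<open>A pair of points is shared when both servers win or both lose their point.\<close>

lemma shared_tiebreak_points:
  fixes x y :: real
  assumes x: "x \<in> {0..1}" and y: "y \<in> {0..1}"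
    and "\<not> (x = 0 \<and> y = 0)" "\<not> (x = 1 \<and> y = 1)"
  shows "0 \<le> x * y + (1 - x) * (1 - y)" "x * y + (1 - x) * (1 - y) < 1"
proof -
  show "0 \<le> x * y + (1 - x) * (1 - y)"
    using x y by simp
  have nonneg: "0 \<le> x * (1 - y)" "0 \<le> (1 - x) * y"
    using x y by simp_all
  have "x * (1 - y) \<noteq> 0 \<or> (1 - x) * y \<noteq> 0"
    using assms by auto
  with nonneg have "0 < x * (1 - y) + (1 - x) * y"
    by linarith
  then show "x * y + (1 - x) * (1 - y) < 1"
    by (simp add: algebra_simps)
qed

text \<open>
  Only the two chances in each pair are prescribed, not their order, so that the lemma covers both
  the tie-breaker in the set and the one with exchanged parameters.
\<close>

lemma tiebreak_value:
  assumes xy: "x \<in> {0..1}" "y \<in> {0..1}" "\<not> (x = 0 \<and> y = 0)" "\<not> (x = 1 \<and> y = 1)"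
    and c: "\<And>n. even n \<Longrightarrow> (c n = x \<and> c (Suc n) = 1 - y) \<or> (c n = 1 - y \<and> c (Suc n) = x)"
    and f: "contest_value K c u v f"
  shows "f (0, 0) = \<theta>\<^sub>S\<^sub>T x y K * u + (1 - \<theta>\<^sub>S\<^sub>T x y K) * v"
  unfolding theta_ST_eq
proof (rule contest_value_unique[where \<rho> = "x * y + (1 - x) * (1 - y)",
      OF f contest_value_affine[OF tiebreak_win_prob_value[OF xy(1,2)]]])
  show "x * y + (1 - x) * (1 - y) < 1"
    by (rule shared_tiebreak_points[OF xy])
next
  fix n :: nat assume n: "even n"
  note cn = c[OF n] tiebreak_chance_pair[OF n, of x y]
  show "c n * c (Suc n) = tiebreak_chance x y n * tiebreak_chance x y (Suc n)"
    using cn by auto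
  show "c n + c (Suc n) = tiebreak_chance x y n + tiebreak_chance x y (Suc n)"
    using cn by auto
  have "c n * (1 - c (Suc n)) + (1 - c n) * c (Suc n) = x * y + (1 - x) * (1 - y)"
    using cn(1) by (elim disjE conjE; simp only:; simp add: algebra_simps)
  then show "\<bar>c n * (1 - c (Suc n)) + (1 - c n) * c (Suc n)\<bar> \<le> x * y + (1 - x) * (1 - y)"
    using shared_tiebreak_points(1)[OF xy] by simp
qed

text \<open>
  With parameters \<open>1 - y\<close> and \<open>1 - x\<close>, A wins own serves as often as A wins the other player's serves
  with parameters \<open>x\<close> and \<open>y\<close>, and vice versa: A's two chances in each pair trade places.
\<close>

lemma theta_ST_exchange:
  assumes "x \<in> {0..1}" "y \<in> {0..1}" "\<not> (x = 0 \<and> y = 0)" "\<not> (x = 1 \<and> y = 1)"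
  shows "\<theta>\<^sub>S\<^sub>T (1 - y) (1 - x) K = \<theta>\<^sub>S\<^sub>T x y K"
proof -
  have "contest_value K (tiebreak_chance (1 - y) (1 - x)) 1 0
      (tiebreak_win_prob (1 - y) (1 - x) K)"
    using assms(1,2) by (intro tiebreak_win_prob_value) auto
  from tiebreak_value[OF assms _ this]
  show ?thesis
    using tiebreak_chance_pair[of _ "1 - y" "1 - x"] by (simp add: theta_ST_eq disj_commute)
qed


section \<open>The set as a walk on the game scores\<close>

definition set_reach :: "nat \<Rightarrow> real \<Rightarrow> real \<Rightarrow> (score \<Rightarrow> bool) \<Rightarrow> score \<Rightarrow> real" where
  "set_reach K x y tgt g = reach_prob (pair_pmf (bernoulli_pmf x) (bernoulli_pmf y))
     (set_step K) (\<lambda>st. tgt (fst st)) (g, (0, 0))"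

lemma wins_set_unique:
  assumes "wins_set v g" "wins_set w g"
  shows "v = w"
proof -
  obtain a b where g: "g = (a, b)" by (cases g)
  have less: "b < a" if "wins_set Player_A (a, b)"
    using that by auto
  have greater: "a < b" if "wins_set Player_B (a, b)"
    using that by auto
  show ?thesis
    using assms less greater unfolding g
    by (cases v; cases w) (auto simp del: wins_set.simps)
qed

definition game_chance :: "real \<Rightarrow> real \<Rightarrow> nat \<Rightarrow> real" where
  "game_chance x y n = (if even n then \<theta>\<^sub>G x else 1 - \<theta>\<^sub>G y)"

lemma theta_S_eq: "\<theta>\<^sub>S x y K = set_reach K x y (wins_set Player_A) (0, 0)"
  by (simp add: \<theta>\<^sub>S_def set_reach_def reach_prob_def points_space_def set_after_def
      del: wins_set.simps)

lemma theta_S_score_eq: "\<theta>\<^sub>S_score K a b x y = set_reach K x y (\<lambda>g. g = (a, b)) (0, 0)"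
  by (simp add: \<theta>\<^sub>S_score_def set_reach_def reach_prob_def points_space_def set_after_def)

lemma set_reach_target: "tgt g \<Longrightarrow> set_reach K x y tgt g = 1"
  by (simp add: set_reach_def reach_prob_target)

lemma set_reach_decided:
  assumes "wins_set v g" "\<not> tgt g"
  shows "set_reach K x y tgt g = 0"
  unfolding set_reach_def
  by (rule reach_prob_unreachable[where I = "\<lambda>st. fst st = g"])
    (use assms in \<open>auto simp: set_step_def simp del: wins_set.simps\<close>)

lemma set_step_score:
  "fst (set_step K u (g, s)) = g \<or> (\<exists>w. fst (set_step K u (g, s)) = add_win w g)"
  by (auto simp: set_step_def Let_def simp del: wins_set.simps)

text \<open>Game scores never decrease, so a score that has been passed cannot occur any more.\<close>

lemma set_reach_overshot:
  assumes "a < fst g \<or> b < snd g"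
  shows "set_reach K x y (\<lambda>g. g = (a, b)) g = 0"
  unfolding set_reach_def
proof (rule reach_prob_unreachable[where I = "\<lambda>st. a < fst (fst st) \<or> b < snd (fst st)"])
  fix u and st :: set_state
  assume "a < fst (fst st) \<or> b < snd (fst st)"
  moreover obtain g' s where "st = (g', s)" by (cases st)
  moreover have "fst g' \<le> fst (add_win w g')" "snd g' \<le> snd (add_win w g')" for w
    by (cases w; cases g'; simp)+
  ultimately show "a < fst (fst (set_step K u st)) \<or> b < snd (fst (set_step K u st))"
    using set_step_score[of K u g' s] by (metis fst_conv order_less_le_trans)
qed (use assms in auto)

text \<open>
  Seen from inside the current game (or tie-breaker), reaching the target is a contest whose stakes
  are the reaching probabilities from the two next game scores. The set replaces a decided point
  score at once by \<open>(0, 0)\<close> of the next game, so the witness takes the stakes as its values at the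
  decided point scores, which do not occur as states of the set.
\<close>

lemma current_game_value:
  fixes K :: nat and x y :: real and tgt :: "score \<Rightarrow> bool" and g :: score
  defines "m \<equiv> (if g = (6, 6) then K else 4)"
  assumes xy: "x \<in> {0..1}" "y \<in> {0..1}"
    and g: "\<And>v. \<not> wins_set v g" "\<not> tgt g"
  shows "\<exists>f. contest_value m
      (\<lambda>n. if (if g = (6, 6) then tiebreak_server Player_A n else game_server g) = Player_A
            then x else 1 - y)
      (set_reach K x y tgt (add_win Player_A g)) (set_reach K x y tgt (add_win Player_B g)) f
    \<and> f (0, 0) = set_reach K x y tgt g"
proof -
  let ?D = "pair_pmf (bernoulli_pmf x) (bernoulli_pmf y)"
  let ?R = "reach_prob ?D (set_step K) (\<lambda>st. tgt (fst st))"
  let ?V = "\<lambda>w. ?R (add_win w g, (0, 0))"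
  define srv where
    "srv n = (if g = (6, 6) then tiebreak_server Player_A n else game_server g)" for n
  define c where "c n = (if srv n = Player_A then x else 1 - y)" for n
  define f where "f s = (if wins_by_two m Player_A s then ?V Player_A
    else if wins_by_two m Player_B s then ?V Player_B else ?R (g, s))" for s
  have point: "f (a, b) = c (a + b) * f (Suc a, b) + (1 - c (a + b)) * f (a, Suc b)"
    if no: "\<And>v. \<not> wins_by_two m v (a, b)" for a b
  proof -
    have srv_eq: "point_server (g, (a, b)) = srv (a + b)"
      by (simp add: point_server_def srv_def game_server_def)
    have next_state: "?R (set_step K u (g, (a, b))) =
        f (add_win (point_winner (srv (a + b)) u) (a, b))" for u
    proof -
      let ?w = "point_winner (srv (a + b)) u"
      have "set_step K u (g, (a, b)) = (if wins_by_two m ?w (add_win ?w (a, b))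
          then (add_win ?w g, (0, 0)) else (g, add_win ?w (a, b)))"
        using g(1) by (simp add: set_step_def Let_def srv_eq m_def del: wins_set.simps wins_by_two.simps)
      moreover have "\<not> wins_by_two m (opponent ?w) (add_win ?w (a, b))"
        using no[of Player_A] no[of Player_B] by (cases ?w) auto
      ultimately show ?thesis
        unfolding f_def by (cases ?w) (simp_all del: wins_by_two.simps)
    qed
    have "f (a, b) = ?R (g, (a, b))"
      using no by (simp add: f_def del: wins_by_two.simps)
    also have "\<dots> = measure_pmf.expectation ?D (\<lambda>u. ?R (set_step K u (g, (a, b))))"
      using g(2) by (intro reach_prob_step) simp
    also have "\<dots> = c (a + b) * f (Suc a, b) + (1 - c (a + b)) * f (a, Suc b)"
      unfolding next_state c_def
      using expectation_point_winner[OF xy, of "\<lambda>w. f (add_win w (a, b))"] by simp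
    finally show ?thesis .
  qed
  have "\<bar>f s\<bar> \<le> 1" for s
    by (simp add: f_def reach_prob_bounds)
  moreover have "wins_by_two m Player_A s \<Longrightarrow> f s = ?V Player_A"
    "wins_by_two m Player_B s \<Longrightarrow> f s = ?V Player_B" for s
    using wins_by_two_unique[of m Player_A s Player_B] by (auto simp: f_def)
  ultimately have "contest_value m c (?V Player_A) (?V Player_B) f"
    unfolding contest_value_def using point by blast
  moreover have "f (0, 0) = ?R (g, (0, 0))"
    by (simp add: f_def)
  ultimately show ?thesis
    unfolding set_reach_def c_def srv_def by blast
qed

lemma set_reach_game:
  assumes xy: "x \<in> {0..1}" "y \<in> {0..1}"
    and g: "\<And>v. \<not> wins_set v (a, b)" "\<not> tgt (a, b)" "(a, b) \<noteq> (6, 6)"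
  shows "set_reach K x y tgt (a, b) =
    game_chance x y (a + b) * set_reach K x y tgt (Suc a, b)
    + (1 - game_chance x y (a + b)) * set_reach K x y tgt (a, Suc b)"
proof -
  define p where "p = (if even (a + b) then x else 1 - y)"
  have "p \<in> {0..1}" using xy by (simp add: p_def)
  moreover have "game_chance x y (a + b) = \<theta>\<^sub>G p"
    using theta_G_complement[OF xy(2)] by (simp add: game_chance_def p_def)
  moreover obtain f where "contest_value 4 (\<lambda>_. p)
      (set_reach K x y tgt (Suc a, b)) (set_reach K x y tgt (a, Suc b)) f"
    "f (0, 0) = set_reach K x y tgt (a, b)"
    using current_game_value[of x y "(a, b)" tgt K] xy g
    by (auto simp: p_def game_server_def simp del: wins_set.simps split: if_splits)
  ultimately show ?thesis
    using game_value by metis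
qed

lemma set_reach_tiebreak:
  assumes xy: "x \<in> {0..1}" "y \<in> {0..1}" "\<not> (x = 0 \<and> y = 0)" "\<not> (x = 1 \<and> y = 1)"
    and tgt: "\<not> tgt (6, 6)"
  shows "set_reach K x y tgt (6, 6) =
    \<theta>\<^sub>S\<^sub>T x y K * set_reach K x y tgt (7, 6) + (1 - \<theta>\<^sub>S\<^sub>T x y K) * set_reach K x y tgt (6, 7)"
proof -
  have "\<not> wins_set v (6, 6)" for v
    by (cases v) auto
  then obtain f where f: "contest_value K (tiebreak_chance x y)
      (set_reach K x y tgt (add_win Player_A (6, 6))) (set_reach K x y tgt (add_win Player_B (6, 6))) f"
    "f (0, 0) = set_reach K x y tgt (6, 6)"
    using current_game_value[of x y "(6, 6)" tgt K] xy tgt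
    by (auto simp: tiebreak_chance_def[abs_def] simp del: wins_set.simps add_win.simps)
  show ?thesis
    using tiebreak_value[OF xy tiebreak_chance_pair f(1)] f(2) by simp
qed


section \<open>The number of games won so far\<close>

lemma binomial_sum_pmf_Suc:
  assumes "r \<in> {0..1}"
  shows "binomial_sum_pmf (Suc m) r n s =
    bernoulli_pmf r \<bind> (\<lambda>b. map_pmf (\<lambda>k. of_bool b + k) (binomial_sum_pmf m r n s))"
  unfolding binomial_sum_pmf_def pair_pmf_def map_pmf_def binomial_pmf_Suc[OF assms]
  by (simp add: bind_assoc_pmf bind_return_pmf add.assoc of_bool_def)

lemma binomial_sum_pmf_commute: "binomial_sum_pmf m r n s = binomial_sum_pmf n s m r"
  unfolding binomial_sum_pmf_def
  by (subst pair_commute_pmf) (simp add: map_pmf_comp case_prod_unfold add.commute)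

lemma set_pmf_binomial_sum:
  assumes "r \<in> {0..1}" "s \<in> {0..1}"
  shows "set_pmf (binomial_sum_pmf m r n s) \<subseteq> {..m + n}"
  using assms by (auto simp: binomial_sum_pmf_def set_pmf_binomial_eq split: if_splits)

lemma expectation_binomial_sum_Suc:
  fixes \<phi> :: "nat \<Rightarrow> real"
  assumes r: "r \<in> {0..1}" and s: "s \<in> {0..1}"
  shows "measure_pmf.expectation (binomial_sum_pmf (Suc m) r n s) \<phi> =
    measure_pmf.expectation (binomial_sum_pmf m r n s) (\<lambda>k. r * \<phi> (Suc k) + (1 - r) * \<phi> k)"
proof -
  have fin: "finite (set_pmf (binomial_sum_pmf m r n s))"
    by (rule finite_subset[OF set_pmf_binomial_sum[OF r s]]) simp
  then have int: "integrable (binomial_sum_pmf m r n s) \<psi>" for \<psi> :: "nat \<Rightarrow> real"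
    by (rule integrable_measure_pmf_finite)
  show ?thesis
    unfolding binomial_sum_pmf_Suc[OF r] using fin r int
    by (subst pmf_expectation_bind[where A = UNIV]) (auto simp: UNIV_bool)
qed

lemma pmf_binomial_sum:
  assumes r: "r \<in> {0..1}" and s: "s \<in> {0..1}"
  shows "pmf (binomial_sum_pmf m r n s) k =
    (\<Sum>j=0..k. real (m choose j) * real (n choose (k - j)) * r ^ j * (1 - r) ^ (m - j)
       * s ^ (k - j) * (1 - s) ^ (n - (k - j)))"
proof -
  have shift: "pmf (map_pmf ((+) i) (binomial_pmf n s)) k =
      (if i \<le> k then pmf (binomial_pmf n s) (k - i) else 0)" for i
  proof (cases "i \<le> k")
    case True
    then have "pmf (map_pmf ((+) i) (binomial_pmf n s)) (i + (k - i)) = pmf (binomial_pmf n s) (k - i)"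
      by (intro pmf_map_inj') simp
    with True show ?thesis by simp
  next
    case False
    then show ?thesis by (auto intro!: pmf_map_outside)
  qed
  have "binomial_sum_pmf m r n s = binomial_pmf m r \<bind> (\<lambda>i. map_pmf ((+) i) (binomial_pmf n s))"
    unfolding binomial_sum_pmf_def pair_pmf_def map_pmf_def
    by (simp add: bind_assoc_pmf bind_return_pmf)
  then have "pmf (binomial_sum_pmf m r n s) k = measure_pmf.expectation (binomial_pmf m r)
      (\<lambda>i. if i \<le> k then pmf (binomial_pmf n s) (k - i) else 0)"
    by (simp add: pmf_bind shift)
  also have "\<dots> = (\<Sum>j=0..k. (if j \<le> k then pmf (binomial_pmf n s) (k - j) else 0)
      * pmf (binomial_pmf m r) j)"
    by (intro integral_measure_pmf_real) (auto split: if_splits)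
  also have "\<dots> = (\<Sum>j=0..k. real (m choose j) * real (n choose (k - j)) * r ^ j * (1 - r) ^ (m - j)
       * s ^ (k - j) * (1 - s) ^ (n - (k - j)))"
    using r s by (intro sum.cong) auto
  finally show ?thesis .
qed

text \<open>
  The mean of \<open>F\<close> over the position after \<open>n\<close> steps does not change with \<open>n\<close>. Step \<open>n + 1\<close> adds a
  trial to the first binomial variable if \<open>n\<close> is even, and to the second if \<open>n\<close> is odd.
\<close>

lemma alternating_walk_expectation:
  fixes F :: "score \<Rightarrow> real"
  assumes r: "r \<in> {0..1}" and s: "s \<in> {0..1}"
    and F: "\<And>a b. a + b < N \<Longrightarrow>
      F (a, b) = (if even (a + b) then r else s) * F (Suc a, b)
        + (1 - (if even (a + b) then r else s)) * F (a, Suc b)"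
  shows "F (0, 0) = measure_pmf.expectation (binomial_sum_pmf (t\<^sub>A N) r (t\<^sub>B N) s) (\<lambda>k. F (k, N - k))"
  using F
proof (induction N)
  case 0
  then show ?case
    using r s by (simp add: t\<^sub>A_def t\<^sub>B_def binomial_sum_pmf_def binomial_pmf_0)
next
  case (Suc N)
  let ?c = "if even N then r else s"
  let ?E = "\<lambda>M. measure_pmf.expectation (binomial_sum_pmf (t\<^sub>A M) r (t\<^sub>B M) s)"
  have "F (0, 0) = ?E N (\<lambda>k. F (k, N - k))"
    using Suc by simp
  also have "\<dots> = ?E N (\<lambda>k. ?c * F (Suc k, Suc N - Suc k) + (1 - ?c) * F (k, Suc N - k))"
  proof (intro integral_cong_AE)
    have "F (k, N - k) = ?c * F (Suc k, Suc N - Suc k) + (1 - ?c) * F (k, Suc N - k)"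
      if "k \<in> set_pmf (binomial_sum_pmf (t\<^sub>A N) r (t\<^sub>B N) s)" for k
    proof -
      have "k \<le> N"
        using set_pmf_binomial_sum[OF r s] that by (fastforce simp: t\<^sub>A_def t\<^sub>B_def)
      with Suc.prems[of k "N - k"] show ?thesis
        by (simp add: Suc_diff_le del: even_diff_nat)
    qed
    then show "AE k in binomial_sum_pmf (t\<^sub>A N) r (t\<^sub>B N) s. F (k, N - k) =
        ?c * F (Suc k, Suc N - Suc k) + (1 - ?c) * F (k, Suc N - k)"
      by (simp add: AE_measure_pmf_iff)
  qed auto
  also have "\<dots> = ?E (Suc N) (\<lambda>k. F (k, Suc N - k))"
  proof (cases "even N")
    case True
    then have "t\<^sub>A (Suc N) = Suc (t\<^sub>A N)" "t\<^sub>B (Suc N) = t\<^sub>B N"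
      by (auto simp: t\<^sub>A_def t\<^sub>B_def elim!: evenE)
    with True show ?thesis
      by (simp only: expectation_binomial_sum_Suc[OF r s] if_True)
  next
    case False
    then have "t\<^sub>A (Suc N) = t\<^sub>A N" "t\<^sub>B (Suc N) = Suc (t\<^sub>B N)"
      by (auto simp: t\<^sub>A_def t\<^sub>B_def elim!: oddE)
    with False show ?thesis
      by (simp only: binomial_sum_pmf_commute[of "t\<^sub>A N" r] expectation_binomial_sum_Suc[OF s r] if_False)
  qed
  finally show ?case .
qed


section \<open>Probabilities of the set scores\<close>

abbreviation games_won :: "real \<Rightarrow> real \<Rightarrow> nat \<Rightarrow> nat pmf" where
  "games_won x y N \<equiv> binomial_sum_pmf (t\<^sub>A N) (\<theta>\<^sub>G x) (t\<^sub>B N) (1 - \<theta>\<^sub>G y)"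

lemma game_chance_bounds: "\<theta>\<^sub>G x \<in> {0..1}" "1 - \<theta>\<^sub>G y \<in> {0..1}"
  using theta_G_bounds[of x] theta_G_bounds[of y] by simp_all

text \<open>
  The walk is continued beyond decided scores. As long as \<open>N \<le> 10\<close>, a player who has won the set
  keeps a winning score in all continuations, so the reaching probability is constant on these
  continuations if the target treats all decided scores of one winner, up to \<open>N\<close> games, alike. This
  is why the \<open>N\<close> for a target \<open>(6, h)\<close> stops one game short of it.
\<close>

lemma set_reach_after_games:
  assumes xy: "x \<in> {0..1}" "y \<in> {0..1}" and N: "N \<le> 10"
    and undecided: "\<And>g. fst g + snd g < N \<Longrightarrow> (\<And>v. \<not> wins_set v g) \<Longrightarrow> \<not> tgt g"
    and decided: "\<And>v g. fst g + snd g \<le> N \<Longrightarrow> wins_set v g \<Longrightarrow> tgt g \<longleftrightarrow> P v"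
  shows "set_reach K x y tgt (0, 0) =
    measure_pmf.expectation (games_won x y N) (\<lambda>k. set_reach K x y tgt (k, N - k))"
proof (rule alternating_walk_expectation[OF game_chance_bounds])
  fix a b assume ab: "a + b < N"
  show "set_reach K x y tgt (a, b) =
      (if even (a + b) then \<theta>\<^sub>G x else 1 - \<theta>\<^sub>G y) * set_reach K x y tgt (Suc a, b)
      + (1 - (if even (a + b) then \<theta>\<^sub>G x else 1 - \<theta>\<^sub>G y)) * set_reach K x y tgt (a, Suc b)"
  proof (cases "\<exists>v. wins_set v (a, b)")
    case False
    then have "\<not> tgt (a, b)" using ab undecided[of "(a, b)"] by simp
    with False ab N set_reach_game[OF xy, of a b tgt K] show ?thesis
      unfolding game_chance_def by (auto simp del: wins_set.simps)
  next
    case True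
    then obtain v where v: "wins_set v (a, b)" ..
    have value_eq: "set_reach K x y tgt g = of_bool (P v)"
      if "wins_set v g" "fst g + snd g \<le> N" for g
      using decided[OF that(2,1)] set_reach_target[of tgt g] set_reach_decided[OF that(1), of tgt]
      by (cases "P v") simp_all
    have "wins_set v (Suc a, b)" "wins_set v (a, Suc b)"
      using v ab N by (cases v; auto)+
    with v ab show ?thesis
      by (simp add: value_eq algebra_simps del: wins_set.simps)
  qed
qed

text \<open>
  The last game before \<open>(6, h)\<close> is won by A from \<open>(5, h)\<close>. After \<open>5 + h\<close> games of the continued walk,
  every other position is either decided or has too many games for B.
\<close>

lemma score_6_prob:
  assumes xy: "x \<in> {0..1}" "y \<in> {0..1}" and h: "h \<le> 4"
  shows "\<theta>\<^sub>S_score K 6 h x y = game_chance x y (5 + h) * pmf (games_won x y (5 + h)) 5"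
proof -
  let ?R = "set_reach K x y (\<lambda>g. g = (6, h))"
  have last_game: "?R (5, h) = game_chance x y (5 + h)"
  proof -
    have "\<not> wins_set v (5, h)" for v using h by (cases v) auto
    then show ?thesis
      using set_reach_game[OF xy, of 5 h "\<lambda>g. g = (6, h)" K]
      by (simp add: set_reach_target set_reach_overshot del: wins_set.simps)
  qed
  have other: "?R (k, 5 + h - k) = 0" if "k \<le> 5 + h" "k \<noteq> 5" for k
  proof (cases "k < 5")
    case True
    then show ?thesis by (intro set_reach_overshot) auto
  next
    case False
    with that h have "wins_set Player_A (k, 5 + h - k)" by auto
    then show ?thesis by (rule set_reach_decided) (use that h in auto)
  qed
  have "\<theta>\<^sub>S_score K 6 h x y =
      measure_pmf.expectation (games_won x y (5 + h)) (\<lambda>k. ?R (k, 5 + h - k))"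
    unfolding theta_S_score_eq
  proof (rule set_reach_after_games[OF xy, where P = "\<lambda>_. False"])
    show "\<not> g = (6, h)" if "fst g + snd g < 5 + h" for g :: score
      using that by auto
    show "g = (6, h) \<longleftrightarrow> False" if "fst g + snd g \<le> 5 + h" for g :: score
      using that by auto
  qed (use h in simp)
  also have "\<dots> = (\<Sum>k\<in>{5}. ?R (k, 5 + h - k) * pmf (games_won x y (5 + h)) k)"
  proof (rule integral_measure_pmf_real)
    fix k assume "k \<in> set_pmf (games_won x y (5 + h))" "?R (k, 5 + h - k) \<noteq> 0"
    moreover from this have "k \<le> 5 + h"
      using set_pmf_binomial_sum[OF game_chance_bounds, of "t\<^sub>A (5 + h)" x "t\<^sub>B (5 + h)" y]
      by (fastforce simp: t\<^sub>A_def t\<^sub>B_def)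
    ultimately show "k \<in> {5}" using other by auto
  qed simp
  also have "\<dots> = game_chance x y (5 + h) * pmf (games_won x y (5 + h)) 5"
    using last_game by simp
  finally show ?thesis .
qed

text \<open>After ten games of the continued walk, every score other than \<open>(5, 5)\<close> is decided.\<close>

lemma score_via_5_5:
  assumes xy: "x \<in> {0..1}" "y \<in> {0..1}" and ab: "5 \<le> a" "5 \<le> b"
  shows "\<theta>\<^sub>S_score K a b x y =
    pmf (games_won x y 10) 5 * set_reach K x y (\<lambda>g. g = (a, b)) (5, 5)"
proof -
  let ?R = "set_reach K x y (\<lambda>g. g = (a, b))"
  have other: "?R (k, 10 - k) = 0" if "k \<noteq> 5" for k
  proof (cases "k < 5")
    case True
    then have "wins_set Player_B (k, 10 - k)" by auto
    then show ?thesis by (rule set_reach_decided) (use True ab in auto)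
  next
    case False
    with that have "wins_set Player_A (k, 10 - k)" by auto
    then show ?thesis by (rule set_reach_decided) (use False that ab in auto)
  qed
  have "\<theta>\<^sub>S_score K a b x y = measure_pmf.expectation (games_won x y 10) (\<lambda>k. ?R (k, 10 - k))"
    unfolding theta_S_score_eq
  proof (rule set_reach_after_games[OF xy, where P = "\<lambda>_. False"])
    show "g = (a, b) \<longleftrightarrow> False" if "fst g + snd g \<le> 10" "wins_set v g" for v g
      using that ab by (cases v) auto
  qed (use ab in auto)
  also have "\<dots> = (\<Sum>k\<in>{5}. ?R (k, 10 - k) * pmf (games_won x y 10) k)"
    using other by (intro integral_measure_pmf_real) auto
  finally show ?thesis by simp
qed

lemma undecided_late_scores:
  "\<not> wins_set v (5, 5)" "\<not> wins_set v (6, 5)" "\<not> wins_set v (5, 6)"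
  by (cases v; simp)+

lemma set_reach_from_5_5:
  assumes xy: "x \<in> {0..1}" "y \<in> {0..1}" and "\<not> tgt (5, 5)" "\<not> tgt (6, 5)" "\<not> tgt (5, 6)"
  shows "set_reach K x y tgt (5, 5) =
    \<theta>\<^sub>G x * (1 - \<theta>\<^sub>G y) * set_reach K x y tgt (7, 5)
    + (\<theta>\<^sub>G x * \<theta>\<^sub>G y + (1 - \<theta>\<^sub>G x) * (1 - \<theta>\<^sub>G y)) * set_reach K x y tgt (6, 6)
    + (1 - \<theta>\<^sub>G x) * \<theta>\<^sub>G y * set_reach K x y tgt (5, 7)"
proof -
  let ?R = "set_reach K x y tgt"
  have "?R (5, 5) = \<theta>\<^sub>G x * ?R (6, 5) + (1 - \<theta>\<^sub>G x) * ?R (5, 6)"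
    using set_reach_game[OF xy undecided_late_scores(1), of tgt K] assms(3)
    by (simp add: game_chance_def)
  moreover have "?R (6, 5) = (1 - \<theta>\<^sub>G y) * ?R (7, 5) + \<theta>\<^sub>G y * ?R (6, 6)"
    using set_reach_game[OF xy undecided_late_scores(2), of tgt K] assms(4)
    by (simp add: game_chance_def)
  moreover have "?R (5, 6) = (1 - \<theta>\<^sub>G y) * ?R (6, 6) + \<theta>\<^sub>G y * ?R (5, 7)"
    using set_reach_game[OF xy undecided_late_scores(3), of tgt K] assms(5)
    by (simp add: game_chance_def)
  ultimately show ?thesis
    by (simp only:) (simp add: algebra_simps)
qed

lemma set_win_prob_binomial:
  assumes xy: "x \<in> {0..1}" "y \<in> {0..1}" "\<not> (x = 0 \<and> y = 0)" "\<not> (x = 1 \<and> y = 1)"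
  shows "\<theta>\<^sub>S x y K =
    measure_pmf.prob (binomial_sum_pmf 5 (\<theta>\<^sub>G x) 5 (1 - \<theta>\<^sub>G y)) {n. n \<ge> 6}
    + measure_pmf.prob (binomial_sum_pmf 5 (\<theta>\<^sub>G x) 5 (1 - \<theta>\<^sub>G y)) {n. n = 5}
      * (\<theta>\<^sub>G x * (1 - \<theta>\<^sub>G y)
         + (\<theta>\<^sub>G x * \<theta>\<^sub>G y + (1 - \<theta>\<^sub>G x) * (1 - \<theta>\<^sub>G y)) * \<theta>\<^sub>S\<^sub>T x y K)"
proof -
  let ?W = "binomial_sum_pmf 5 (\<theta>\<^sub>G x) 5 (1 - \<theta>\<^sub>G y)"
  let ?R = "set_reach K x y (wins_set Player_A)"
  have lost: "wins_set Player_B g \<Longrightarrow> ?R g = 0" for g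
    using wins_set_unique[of Player_A g Player_B] by (intro set_reach_decided[of Player_B]) blast+
  have "?R (7, 6) = 1" "?R (7, 5) = 1" "?R (6, 7) = 0" "?R (5, 7) = 0"
    by (simp_all add: set_reach_target lost)
  moreover from this have "?R (6, 6) = \<theta>\<^sub>S\<^sub>T x y K"
    using set_reach_tiebreak[OF xy, of "wins_set Player_A" K] by simp
  ultimately have R55: "?R (5, 5) = \<theta>\<^sub>G x * (1 - \<theta>\<^sub>G y)
      + (\<theta>\<^sub>G x * \<theta>\<^sub>G y + (1 - \<theta>\<^sub>G x) * (1 - \<theta>\<^sub>G y)) * \<theta>\<^sub>S\<^sub>T x y K"
    using set_reach_from_5_5[OF xy(1,2), of "wins_set Player_A" K] undecided_late_scores
    by (simp del: wins_set.simps)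
  have level10: "?R (k, 10 - k) = indicator {n. n \<ge> 6} k + indicator {n. n = 5} k * ?R (5, 5)" for k
  proof (cases k "5 :: nat" rule: linorder_cases)
    case less
    then have "wins_set Player_B (k, 10 - k)" by auto
    with less show ?thesis by (simp add: lost del: wins_set.simps)
  next
    case greater
    then have "wins_set Player_A (k, 10 - k)" by auto
    with greater show ?thesis by (simp add: set_reach_target del: wins_set.simps)
  qed simp
  have "\<theta>\<^sub>S x y K = measure_pmf.expectation (games_won x y 10) (\<lambda>k. ?R (k, 10 - k))"
    unfolding theta_S_eq
  proof (rule set_reach_after_games[OF xy(1,2), where P = "\<lambda>v. v = Player_A"])
    show "wins_set Player_A g \<longleftrightarrow> v = Player_A" if "wins_set v g" for v g
      using that wins_set_unique[of Player_A g v] by auto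
    show "\<not> wins_set Player_A g" if "\<And>v. \<not> wins_set v g" for g
      by (rule that)
  qed simp
  also have "\<dots> = measure_pmf.expectation ?W
      (\<lambda>k. indicator {n. n \<ge> 6} k + indicator {n. n = 5} k * ?R (5, 5))"
    by (simp only: level10) (simp add: t\<^sub>A_def t\<^sub>B_def)
  also have "\<dots> = measure_pmf.prob ?W {n. n \<ge> 6} + measure_pmf.prob ?W {n. n = 5} * ?R (5, 5)"
  proof (subst Bochner_Integration.integral_add)
    show "integrable ?W (\<lambda>k. indicator {n. n \<ge> 6} k :: real)"
      by (rule measure_pmf.integrable_const_bound[where B = 1]) auto
    show "integrable ?W (\<lambda>k. indicator {n. n = 5} k * ?R (5, 5))"
      by (rule measure_pmf.integrable_const_bound[where B = "\<bar>?R (5, 5)\<bar>"])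
        (auto simp: indicator_def)
  qed simp
  finally show ?thesis unfolding R55 .
qed

text \<open>
  The two sides, as functions of the current game score, satisfy the same first-step equation and
  agree where A or B has just won the set, and at \<open>(6, 6)\<close>. Backward induction compares them at
  \<open>(0, 0)\<close>. It is restricted to scores up to 6 games, since at winning scores that never arise, such as
  \<open>(8, 0)\<close>, the two sides differ.
\<close>

lemma set_win_prob_scores:
  assumes xy: "x \<in> {0..1}" "y \<in> {0..1}" "\<not> (x = 0 \<and> y = 0)" "\<not> (x = 1 \<and> y = 1)"
  shows "\<theta>\<^sub>S x y K = (\<Sum>h=0..4. \<theta>\<^sub>S_score K 6 h x y) + \<theta>\<^sub>S_score K 7 5 x y
    + \<theta>\<^sub>S_score K 6 6 x y * \<theta>\<^sub>S\<^sub>T x y K"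
proof -
  let ?R = "set_reach K x y"
  define Q where "Q h g = ?R (\<lambda>g. g = (6, h)) g" for h g
  define Q75 where "Q75 g = ?R (\<lambda>g. g = (7, 5)) g" for g
  define D where "D g = ?R (wins_set Player_A) g
    - ((\<Sum>h=0..4. Q h g) + Q75 g + Q 6 g * \<theta>\<^sub>S\<^sub>T x y K)" for g
  have B: "D g = 0" if "wins_set Player_B g" for g
  proof -
    have nA: "\<not> wins_set Player_A g"
      using that wins_set_unique[of Player_A g Player_B] by blast
    have "Q h g = 0" if "h \<le> 4 \<or> h = 6" for h
      unfolding Q_def by (rule set_reach_decided[OF \<open>wins_set Player_B g\<close>])
        (use \<open>wins_set Player_B g\<close> that in auto)
    then have "(\<Sum>h=0..4. Q h g) = 0" "Q 6 g = 0"
      by (auto intro!: sum.neutral)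
    moreover have "Q75 g = 0"
      unfolding Q75_def by (rule set_reach_decided[OF that]) (use that in auto)
    moreover have "?R (wins_set Player_A) g = 0"
      by (rule set_reach_decided[of Player_B]) (use that nA in blast)+
    ultimately show ?thesis
      by (simp add: D_def)
  qed
  have A6: "D (6, b) = 0" if "b \<le> 4" for b
  proof -
    have win: "wins_set Player_A (6, b)" using that by auto
    have "Q h (6, b) = (if h = b then 1 else 0)" for h
      using set_reach_target[of "\<lambda>g. g = (6, h)" "(6, b)"]
        set_reach_decided[OF win, of "\<lambda>g. g = (6, h)"] unfolding Q_def by auto
    then have "(\<Sum>h=0..4. Q h (6, b)) = 1" "Q 6 (6, b) = 0"
      using that by simp_all
    moreover have "Q75 (6, b) = 0"
      unfolding Q75_def by (rule set_reach_decided[OF win]) simp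
    moreover have "?R (wins_set Player_A) (6, b) = 1"
      by (rule set_reach_target) (rule win)
    ultimately show ?thesis
      by (simp add: D_def)
  qed
  have A75: "D (7, 5) = 0"
  proof -
    have "Q h (7, 5) = 0" for h
      unfolding Q_def by (rule set_reach_overshot) simp
    moreover have "Q75 (7, 5) = 1"
      unfolding Q75_def by (rule set_reach_target) simp
    moreover have "?R (wins_set Player_A) (7, 5) = 1"
      by (rule set_reach_target) simp
    ultimately show ?thesis
      by (simp add: D_def)
  qed
  have D66: "D (6, 6) = 0"
  proof -
    have "?R (wins_set Player_A) (7, 6) = 1"
      by (rule set_reach_target) simp
    moreover have "?R (wins_set Player_A) (6, 7) = 0"
      by (rule set_reach_decided[of Player_B]) auto
    moreover have "\<not> wins_set Player_A (6, 6)"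
      by simp
    ultimately have "?R (wins_set Player_A) (6, 6) = \<theta>\<^sub>S\<^sub>T x y K"
      using set_reach_tiebreak[OF xy, of "wins_set Player_A" K] by simp
    moreover have "Q h (6, 6) = 0" if "h \<le> 4" for h
      unfolding Q_def by (rule set_reach_overshot) (use that in simp)
    then have "(\<Sum>h=0..4. Q h (6, 6)) = 0"
      by (intro sum.neutral) auto
    moreover have "Q75 (6, 6) = 0"
      unfolding Q75_def by (rule set_reach_overshot) simp
    moreover have "Q 6 (6, 6) = 1"
      unfolding Q_def by (rule set_reach_target) simp
    ultimately show ?thesis
      by (simp add: D_def)
  qed
  have step: "D (a, b) = game_chance x y (a + b) * D (Suc a, b)
      + (1 - game_chance x y (a + b)) * D (a, Suc b)"
    if no: "\<And>v. \<not> wins_set v (a, b)" and "(a, b) \<noteq> (6, 6)" for a b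
  proof -
    let ?c = "game_chance x y (a + b)"
    have Q: "Q h (a, b) = ?c * Q h (Suc a, b) + (1 - ?c) * Q h (a, Suc b)"
      if "h \<le> 4 \<or> h = 6" for h
      using no[of Player_A] \<open>(a, b) \<noteq> (6, 6)\<close> that unfolding Q_def
      by (intro set_reach_game[OF xy(1,2) no]) auto
    have Q75: "Q75 (a, b) = ?c * Q75 (Suc a, b) + (1 - ?c) * Q75 (a, Suc b)"
      using no[of Player_A] \<open>(a, b) \<noteq> (6, 6)\<close> unfolding Q75_def
      by (intro set_reach_game[OF xy(1,2) no]) auto
    have "(\<Sum>h=0..4. Q h (a, b)) = (\<Sum>h=0..4. ?c * Q h (Suc a, b) + (1 - ?c) * Q h (a, Suc b))"
      by (rule sum.cong) (simp_all add: Q)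
    then have sum_Q: "(\<Sum>h=0..4. Q h (a, b)) =
        ?c * (\<Sum>h=0..4. Q h (Suc a, b)) + (1 - ?c) * (\<Sum>h=0..4. Q h (a, Suc b))"
      by (simp only: sum.distrib sum_distrib_left)
    have win: "?R (wins_set Player_A) (a, b) = ?c * ?R (wins_set Player_A) (Suc a, b)
        + (1 - ?c) * ?R (wins_set Player_A) (a, Suc b)"
      using no that(2) by (intro set_reach_game[OF xy(1,2)]) blast+
    have Q6: "Q 6 (a, b) = ?c * Q 6 (Suc a, b) + (1 - ?c) * Q 6 (a, Suc b)"
      by (rule Q) simp
    show ?thesis
      unfolding D_def sum_Q Q75 Q6 win by (simp add: algebra_simps)
  qed
  have "D (a, b) = 0" if "\<And>v. \<not> wins_set v (a, b)" "a \<le> 6" "b \<le> 6" for a b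
    using that
  proof (induction "12 - (a + b)" arbitrary: a b rule: less_induct)
    case less
    note no = less.prems(1)
    show ?case
    proof (cases "(a, b) = (6, 6)")
      case True
      then show ?thesis using D66 by simp
    next
      case False
      have le: "a + b < 12" using less.prems(2,3) False by auto
      have "D (Suc a, b) = 0"
      proof (cases "\<exists>v. wins_set v (Suc a, b)")
        case True
        then obtain v where "wins_set v (Suc a, b)" ..
        then have "Suc a = 6 \<and> b \<le> 4 \<or> Suc a = 7 \<and> b = 5"
          using no[of v] less.prems(2,3) False by (cases v) auto
        then show ?thesis using A6[of b] A75 by (elim disjE) auto
      next
        case undecided: False
        then have "\<not> wins_set Player_A (Suc a, b)" by blast
        then have "Suc a \<le> 6"
          using no[of Player_A] less.prems(2,3) False by auto
        with undecided show ?thesis using le less.prems(3) by (intro less.hyps) (blast | simp)+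
      qed
      moreover have "D (a, Suc b) = 0"
      proof (cases "\<exists>v. wins_set v (a, Suc b)")
        case True
        then obtain v where v: "wins_set v (a, Suc b)" ..
        then have "v = Player_B"
          using no[of v] less.prems(2,3) False by (cases v) auto
        with v have "wins_set Player_B (a, Suc b)" by blast
        then show ?thesis by (rule B)
      next
        case undecided: False
        then have "\<not> wins_set Player_B (a, Suc b)" by blast
        then have "Suc b \<le> 6"
          using no[of Player_B] less.prems(2,3) False by auto
        with undecided show ?thesis using le less.prems(2) by (intro less.hyps) (blast | simp)+
      qed
      ultimately show ?thesis using step[OF no False] by simp
    qed
  qed
  moreover have "\<not> wins_set v (0, 0)" for v
    by (cases v) auto
  ultimately have "D (0, 0) = 0"
    by blast
  then show ?thesis
    by (simp add: D_def Q_def Q75_def theta_S_eq theta_S_score_eq)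
qed

lemma set_win_prob_exchange:
  assumes xy: "x \<in> {0..1}" "y \<in> {0..1}" "\<not> (x = 0 \<and> y = 0)" "\<not> (x = 1 \<and> y = 1)"
  shows "\<theta>\<^sub>S (1 - y) (1 - x) K = \<theta>\<^sub>S x y K"
proof -
  have xy': "1 - y \<in> {0..1}" "1 - x \<in> {0..1}"
    "\<not> (1 - y = 0 \<and> 1 - x = 0)" "\<not> (1 - y = 1 \<and> 1 - x = 1)"
    using xy by auto
  show ?thesis
    unfolding set_win_prob_binomial[OF xy] set_win_prob_binomial[OF xy']
      theta_G_complement[OF xy(1)] theta_G_complement[OF xy(2)] theta_ST_exchange[OF xy]
    by (simp add: binomial_sum_pmf_commute[of 5 "1 - \<theta>\<^sub>G y"] algebra_simps)
qed

theorem theorem3p6: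
  fixes K :: nat and p\<^sub>A p\<^sub>B q\<^sub>A q\<^sub>B :: real
  assumes "K > 0"
    and "p\<^sub>A \<in> {0..1}" and "p\<^sub>B \<in> {0..1}"
    and "\<not> (p\<^sub>A = 0 \<and> p\<^sub>B = 0)" and "\<not> (p\<^sub>A = 1 \<and> p\<^sub>B = 1)"
    and "q\<^sub>A = 1 - p\<^sub>A" and "q\<^sub>B = 1 - p\<^sub>B"
  shows
    "\<theta>\<^sub>S p\<^sub>A p\<^sub>B K =
        (\<Sum>h=0..4. \<theta>\<^sub>S_score K 6 h p\<^sub>A p\<^sub>B) + \<theta>\<^sub>S_score K 7 5 p\<^sub>A p\<^sub>B
        + \<theta>\<^sub>S_score K 6 6 p\<^sub>A p\<^sub>B * \<theta>\<^sub>S\<^sub>T p\<^sub>A p\<^sub>B K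
     \<and> (\<forall>h\<in>{0..4}. \<theta>\<^sub>S_score K 6 h p\<^sub>A p\<^sub>B =
          \<theta>\<^sub>G p\<^sub>A ^ J\<^sub>A (6 + h) * (1 - \<theta>\<^sub>G p\<^sub>B) ^ (1 - J\<^sub>A (6 + h)) *
          (\<Sum>j=0..5.
             real (t\<^sub>A (6 + h - 1) choose j) * real (t\<^sub>B (6 + h - 1) choose (5 - j))
             * \<theta>\<^sub>G p\<^sub>A ^ j * (1 - \<theta>\<^sub>G p\<^sub>A) ^ (t\<^sub>A (6 + h - 1) - j)
             * (1 - \<theta>\<^sub>G p\<^sub>B) ^ (5 - j) * \<theta>\<^sub>G p\<^sub>B ^ (t\<^sub>B (6 + h - 1) - (5 - j))))
     \<and> \<theta>\<^sub>S_score K 5 5 p\<^sub>A p\<^sub>B =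
          (\<Sum>j=0..5. real (5 choose j) ^ 2 * (\<theta>\<^sub>G p\<^sub>A * \<theta>\<^sub>G p\<^sub>B) ^ j
             * ((1 - \<theta>\<^sub>G p\<^sub>A) * (1 - \<theta>\<^sub>G p\<^sub>B)) ^ (5 - j))
     \<and> \<theta>\<^sub>S_score K 7 5 p\<^sub>A p\<^sub>B = \<theta>\<^sub>S_score K 5 5 p\<^sub>A p\<^sub>B * \<theta>\<^sub>G p\<^sub>A * (1 - \<theta>\<^sub>G p\<^sub>B)
     \<and> \<theta>\<^sub>S_score K 6 6 p\<^sub>A p\<^sub>B =
          \<theta>\<^sub>S_score K 5 5 p\<^sub>A p\<^sub>B
          * (\<theta>\<^sub>G p\<^sub>A * \<theta>\<^sub>G p\<^sub>B + (1 - \<theta>\<^sub>G p\<^sub>A) * (1 - \<theta>\<^sub>G p\<^sub>B))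
     \<and> \<theta>\<^sub>S p\<^sub>A p\<^sub>B K =
          measure_pmf.prob (binomial_sum_pmf 5 (\<theta>\<^sub>G p\<^sub>A) 5 (1 - \<theta>\<^sub>G p\<^sub>B)) {n. n \<ge> 6}
          + measure_pmf.prob (binomial_sum_pmf 5 (\<theta>\<^sub>G p\<^sub>A) 5 (1 - \<theta>\<^sub>G p\<^sub>B)) {n. n = 5}
            * (\<theta>\<^sub>G p\<^sub>A * (1 - \<theta>\<^sub>G p\<^sub>B)
               + (\<theta>\<^sub>G p\<^sub>A * \<theta>\<^sub>G p\<^sub>B + (1 - \<theta>\<^sub>G p\<^sub>A) * (1 - \<theta>\<^sub>G p\<^sub>B))
                 * \<theta>\<^sub>S\<^sub>T p\<^sub>A p\<^sub>B K)
     \<and> \<theta>\<^sub>S p\<^sub>A p\<^sub>B K = \<theta>\<^sub>S q\<^sub>B q\<^sub>A K"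
proof (intro conjI ballI)
  note xy = assms(2,3,4,5)
  have pmf_5_5: "pmf (games_won p\<^sub>A p\<^sub>B 10) 5 =
      (\<Sum>j=0..5. real (5 choose j) ^ 2 * (\<theta>\<^sub>G p\<^sub>A * \<theta>\<^sub>G p\<^sub>B) ^ j
         * ((1 - \<theta>\<^sub>G p\<^sub>A) * (1 - \<theta>\<^sub>G p\<^sub>B)) ^ (5 - j))"
    unfolding pmf_binomial_sum[OF game_chance_bounds]
  proof (rule sum.cong)
    fix j :: nat assume j: "j \<in> {0..5}"
    have "5 choose (5 - j) = 5 choose j" "5 - (5 - j) = j"
      using j binomial_symmetric[of j 5] by auto
    moreover have "t\<^sub>A 10 = 5" "t\<^sub>B 10 = 5"
      by (simp_all add: t\<^sub>A_def t\<^sub>B_def)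
    ultimately show "real (t\<^sub>A 10 choose j) * real (t\<^sub>B 10 choose (5 - j)) * \<theta>\<^sub>G p\<^sub>A ^ j
        * (1 - \<theta>\<^sub>G p\<^sub>A) ^ (t\<^sub>A 10 - j) * (1 - \<theta>\<^sub>G p\<^sub>B) ^ (5 - j)
        * (1 - (1 - \<theta>\<^sub>G p\<^sub>B)) ^ (t\<^sub>B 10 - (5 - j)) =
      real (5 choose j) ^ 2 * (\<theta>\<^sub>G p\<^sub>A * \<theta>\<^sub>G p\<^sub>B) ^ j
        * ((1 - \<theta>\<^sub>G p\<^sub>A) * (1 - \<theta>\<^sub>G p\<^sub>B)) ^ (5 - j)"
      by (simp add: power_mult_distrib power2_eq_square)
  qed simp
  have S55: "\<theta>\<^sub>S_score K 5 5 p\<^sub>A p\<^sub>B = pmf (games_won p\<^sub>A p\<^sub>B 10) 5"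
    by (simp add: score_via_5_5[OF xy(1,2)] set_reach_target)
  show "\<theta>\<^sub>S p\<^sub>A p\<^sub>B K = (\<Sum>h=0..4. \<theta>\<^sub>S_score K 6 h p\<^sub>A p\<^sub>B) + \<theta>\<^sub>S_score K 7 5 p\<^sub>A p\<^sub>B
      + \<theta>\<^sub>S_score K 6 6 p\<^sub>A p\<^sub>B * \<theta>\<^sub>S\<^sub>T p\<^sub>A p\<^sub>B K"
    by (rule set_win_prob_scores[OF xy])
  show "\<theta>\<^sub>S_score K 5 5 p\<^sub>A p\<^sub>B =
      (\<Sum>j=0..5. real (5 choose j) ^ 2 * (\<theta>\<^sub>G p\<^sub>A * \<theta>\<^sub>G p\<^sub>B) ^ j
         * ((1 - \<theta>\<^sub>G p\<^sub>A) * (1 - \<theta>\<^sub>G p\<^sub>B)) ^ (5 - j))"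
    unfolding S55 by (rule pmf_5_5)
  have "set_reach K p\<^sub>A p\<^sub>B (\<lambda>g. g = (7, 5)) (5, 5) = \<theta>\<^sub>G p\<^sub>A * (1 - \<theta>\<^sub>G p\<^sub>B)"
    by (subst set_reach_from_5_5[OF xy(1,2)]) (simp_all add: set_reach_target set_reach_overshot)
  then show "\<theta>\<^sub>S_score K 7 5 p\<^sub>A p\<^sub>B = \<theta>\<^sub>S_score K 5 5 p\<^sub>A p\<^sub>B * \<theta>\<^sub>G p\<^sub>A * (1 - \<theta>\<^sub>G p\<^sub>B)"
    unfolding S55 by (simp add: score_via_5_5[OF xy(1,2)])
  have "set_reach K p\<^sub>A p\<^sub>B (\<lambda>g. g = (6, 6)) (5, 5) =
      \<theta>\<^sub>G p\<^sub>A * \<theta>\<^sub>G p\<^sub>B + (1 - \<theta>\<^sub>G p\<^sub>A) * (1 - \<theta>\<^sub>G p\<^sub>B)"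
    by (subst set_reach_from_5_5[OF xy(1,2)]) (simp_all add: set_reach_target set_reach_overshot)
  then show "\<theta>\<^sub>S_score K 6 6 p\<^sub>A p\<^sub>B = \<theta>\<^sub>S_score K 5 5 p\<^sub>A p\<^sub>B
      * (\<theta>\<^sub>G p\<^sub>A * \<theta>\<^sub>G p\<^sub>B + (1 - \<theta>\<^sub>G p\<^sub>A) * (1 - \<theta>\<^sub>G p\<^sub>B))"
    unfolding S55 by (simp add: score_via_5_5[OF xy(1,2)])
  show "\<theta>\<^sub>S p\<^sub>A p\<^sub>B K =
      measure_pmf.prob (binomial_sum_pmf 5 (\<theta>\<^sub>G p\<^sub>A) 5 (1 - \<theta>\<^sub>G p\<^sub>B)) {n. n \<ge> 6}
      + measure_pmf.prob (binomial_sum_pmf 5 (\<theta>\<^sub>G p\<^sub>A) 5 (1 - \<theta>\<^sub>G p\<^sub>B)) {n. n = 5}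
        * (\<theta>\<^sub>G p\<^sub>A * (1 - \<theta>\<^sub>G p\<^sub>B)
           + (\<theta>\<^sub>G p\<^sub>A * \<theta>\<^sub>G p\<^sub>B + (1 - \<theta>\<^sub>G p\<^sub>A) * (1 - \<theta>\<^sub>G p\<^sub>B))
             * \<theta>\<^sub>S\<^sub>T p\<^sub>A p\<^sub>B K)"
    by (rule set_win_prob_binomial[OF xy])
  show "\<theta>\<^sub>S p\<^sub>A p\<^sub>B K = \<theta>\<^sub>S q\<^sub>B q\<^sub>A K"
    unfolding assms(6,7) by (rule set_win_prob_exchange[OF xy, symmetric])
next
  fix h :: nat assume "h \<in> {0..4}"
  then have h: "h \<le> 4" by simp
  have "game_chance p\<^sub>A p\<^sub>B (5 + h) = \<theta>\<^sub>G p\<^sub>A ^ J\<^sub>A (6 + h) * (1 - \<theta>\<^sub>G p\<^sub>B) ^ (1 - J\<^sub>A (6 + h))"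
    by (cases "even h") (auto simp: game_chance_def J\<^sub>A_def elim!: evenE oddE)
  moreover have "6 + h - 1 = 5 + h" by simp
  ultimately show "\<theta>\<^sub>S_score K 6 h p\<^sub>A p\<^sub>B =
      \<theta>\<^sub>G p\<^sub>A ^ J\<^sub>A (6 + h) * (1 - \<theta>\<^sub>G p\<^sub>B) ^ (1 - J\<^sub>A (6 + h)) *
      (\<Sum>j=0..5.
         real (t\<^sub>A (6 + h - 1) choose j) * real (t\<^sub>B (6 + h - 1) choose (5 - j))
         * \<theta>\<^sub>G p\<^sub>A ^ j * (1 - \<theta>\<^sub>G p\<^sub>A) ^ (t\<^sub>A (6 + h - 1) - j)
         * (1 - \<theta>\<^sub>G p\<^sub>B) ^ (5 - j) * \<theta>\<^sub>G p\<^sub>B ^ (t\<^sub>B (6 + h - 1) - (5 - j)))"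
    by (simp add: score_6_prob[OF assms(2,3) h] pmf_binomial_sum[OF game_chance_bounds])
qed

end
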